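(* Let $R$ be a factorial domain, $K$ a field of quotients of $R$, $X$ an indeterminate over $K$ and $f\in R[X]^{\bullet}$. Then $$\{P\in\mathfrak{X}([\![f]\!])\mid P\cap R=\emptyset\}=\{gK[X]\cap[\![f]\!]\mid g\in([\![f]\!]\cap\mathcal{A}(R[X]))\setminus R\}=\{gK[X]\cap[\![f]\!]\mid g\in[\![f]\!]\cap\mathcal{A}(K[X])\}.$$ In particular, if $\mathcal{R}$ is a system of representatives of $([\![f]\!]\cap\mathcal{A}(R[X]))\setminus R$, then the map $\mathcal{R}\rightarrow\{P\in\mathfrak{X}([\![f]\!])\mid P\cap R=\emptyset\}$, $t\mapsto tK[X]\cap[\![f]\!]$, is a bijection.
   Context: Monoids are commutative and cancellative with identity; for a domain $D$, $D^{\bullet}=D\setminus\{0\}$ is a multiplicative monoid; $\mathcal{A}(\cdot)$ denotes the set of atoms. For a monoid $H$: an $s$-ideal is a subset $I\subseteq H$ with $IH=I$ (the empty set is allowed); it is prime if $I\neq H$ and $H\setminus I$ is a submonoid. $\mathfrak{X}(H)$ is the set of minimal nonempty prime $s$-ideals of $H$. A system of representatives of $E\subseteq H$ is a subset $F\subseteq E$ such that every $x\in E$ is associated (equal up to a unit of $H$) to exactly one $y\in F$. ${\rm Int}(R)=\{g\in K[X]\mid g(x)\in R\text{ for all }x\in R\}$. For $f\in{\rm Int}(R)^{\bullet}$, $[\![f]\!]=\{g\in{\rm Int}(R)^{\bullet}\mid g\text{ divides }f^k\text{ in }{\rm Int}(R)\text{ for some }k\in\mathbb{N}_0\}$; it is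 known that $[\![f]\!]$ is a Krull monoid; its unit group is $R^{\times}$. *)

theory Defs
  imports "HOL-Computational_Algebra.Computational_Algebra"
begin

text \<open>
  Monoids are given as submonoids \<open>H\<close> of the multiplicative monoid of a type. Units,
  associatedness and ideals are relative to \<open>H\<close>, not to the ambient type.
\<close>

definition is_submonoid :: "'b::comm_monoid_mult set \<Rightarrow> bool" where
  "is_submonoid S \<longleftrightarrow> 1 \<in> S \<and> (\<forall>x\<in>S. \<forall>y\<in>S. x * y \<in> S)"

definition monoid_units :: "'b::comm_monoid_mult set \<Rightarrow> 'b set" where
  "monoid_units H = {u \<in> H. \<exists>v\<in>H. u * v = 1}"

definition associated_in :: "'b::comm_monoid_mult set \<Rightarrow> 'b \<Rightarrow> 'b \<Rightarrow> bool" where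
  "associated_in H x y \<longleftrightarrow> (\<exists>u\<in>monoid_units H. x = u * y)"

definition system_of_representatives ::
    "'b::comm_monoid_mult set \<Rightarrow> 'b set \<Rightarrow> 'b set \<Rightarrow> bool" where
  "system_of_representatives H E F \<longleftrightarrow>
     F \<subseteq> E \<and> (\<forall>x\<in>E. \<exists>!y. y \<in> F \<and> associated_in H x y)"

definition s_ideal :: "'b::comm_monoid_mult set \<Rightarrow> 'b set \<Rightarrow> bool" where
  "s_ideal H I \<longleftrightarrow> I \<subseteq> H \<and> {x * h | x h. x \<in> I \<and> h \<in> H} = I"

definition prime_s_ideal :: "'b::comm_monoid_mult set \<Rightarrow> 'b set \<Rightarrow> bool" where
  "prime_s_ideal H P \<longleftrightarrow> s_ideal H P \<and> P \<noteq> H \<and> is_submonoid (H - P)"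

definition minimal_prime_s_ideals :: "'b::comm_monoid_mult set \<Rightarrow> 'b set set"  ("\<XX>") where
  "\<XX> H = {P. prime_s_ideal H P \<and> P \<noteq> {} \<and>
             (\<forall>Q. prime_s_ideal H Q \<and> Q \<noteq> {} \<and> Q \<subseteq> P \<longrightarrow> Q = P)}"

text \<open>
  The domain \<open>R\<close> is a type \<open>'a\<close>, its field of quotients \<open>K\<close> is \<^typ>\<open>'a fract\<close>, and everything
  is considered inside \<open>K[X]\<close>, that is, \<^typ>\<open>'a fract poly\<close>.
\<close>

definition int_valued :: "'a::idom fract poly set" where
  "int_valued = {g. \<forall>x. poly g (to_fract x) \<in> range to_fract}"

definition const_polys :: "'a::idom fract poly set" where
  "const_polys = range (\<lambda>r. [:to_fract r:])"

text \<open>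
  In an integral domain \<open>D\<close>, the atoms of the monoid \<open>D - {0}\<close> are exactly the elements
  satisfying \<^const>\<open>irreducible\<close>.
\<close>

definition atoms_RX :: "'a::idom fract poly set" where
  "atoms_RX = fract_poly ` {p. irreducible p}"

definition atoms_KX :: "'a::idom fract poly set" where
  "atoms_KX = {p. irreducible p}"

definition divisor_monoid :: "'a::idom fract poly \<Rightarrow> 'a fract poly set" where
  "divisor_monoid f = {g \<in> int_valued - {0}. \<exists>k::nat. \<exists>h\<in>int_valued. f ^ k = g * h}"

definition KX_multiples :: "'a::idom fract poly \<Rightarrow> 'a fract poly set" where
  "KX_multiples g = range (\<lambda>q. g * q)"

end

theory Submission
  imports Defs
begin

text \<open>
  Let \<open>H\<close> be the divisor monoid of \<open>f\<close>. Gauss's lemma shows that every \<open>h \<in> H\<close> has a denominator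
  \<open>d \<in> R \<inter> H\<close>, that is, \<open>d h \<in> R[X]\<close>. A nonempty prime \<open>s\<close>-ideal \<open>P\<close> of \<open>H\<close> disjoint from \<open>R\<close>
  therefore meets \<open>R[X]\<close>, and the primitive part of an element of least degree in \<open>P \<inter> R[X]\<close> is
  an atom \<open>g\<close> of \<open>R[X]\<close> in \<open>P\<close>. Cancelling denominators by primality gives
  \<open>g K[X] \<inter> H \<subseteq> P\<close>. As atoms dividing each other are associated, this yields both the
  minimality of the ideals \<open>g K[X] \<inter> H\<close> and the fact that they exhaust the minimal primes
  disjoint from \<open>R\<close>.
\<close>

section \<open>Primitive polynomials over a factorial domain\<close>

text \<open>Phrased through prime constants rather than through a content, since a factorial domain
  carries no chosen gcd. The zero polynomial satisfies it exactly when \<open>R\<close> has no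
  primes, that is, when \<open>R\<close> is a field.\<close>

definition primitive_poly :: "'a::{factorial_semiring, idom} poly \<Rightarrow> bool" where
  "primitive_poly p \<longleftrightarrow> (\<forall>q. prime q \<longrightarrow> \<not> [:q:] dvd p)"

text \<open>A prime of \<open>R\<close> stays prime in \<open>R[X]\<close>, so each prime factor of
  \<open>d\<close>, not dividing \<open>p\<close>, must divide \<open>q\<close>; the induction
  strips these factors off one at a time. Only the primes of \<open>d\<close> are restricted, so
  \<open>p\<close> may itself be a constant coprime to \<open>d\<close>.\<close>

lemma const_dvd_mult_cancel:
  fixes p q :: "'a::{factorial_semiring, idom} poly"
  assumes "d \<noteq> 0" "\<And>r. prime r \<Longrightarrow> r dvd d \<Longrightarrow> \<not> [:r:] dvd p" "[:d:] dvd p * q"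
  shows "[:d:] dvd q"
  using assms
proof (induction d arbitrary: q rule: prime_divisors_induct)
  case zero
  then show ?case by simp
next
  case (unit x)
  then show ?case by (simp add: const_poly_dvd_iff unit_imp_dvd)
next
  case (factor r x)
  have eq: "[:r * x:] = [:r:] * [:x:]" by simp
  have "[:r:] dvd p * q" using factor.prems(3) unfolding eq by (rule dvd_mult_left)
  moreover have "prime_elem [:r:]" using factor.hyps by (simp add: lift_prime_elem_poly)
  moreover have "\<not> [:r:] dvd p" using factor.prems(2) factor.hyps by simp
  ultimately obtain q' where q': "q = [:r:] * q'"
    by (auto simp: prime_elem_dvd_mult_iff)
  have r0: "[:r:] \<noteq> 0" using factor.hyps by auto
  have "[:r:] * [:x:] dvd [:r:] * (p * q')"
    using factor.prems(3) unfolding eq q' by (simp only: mult.left_commute)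
  then have "[:x:] dvd p * q'" using r0 by (simp only: dvd_mult_cancel_left) simp
  moreover have "x \<noteq> 0" using factor.prems by auto
  moreover have "\<not> [:s:] dvd p" if "prime s" "s dvd x" for s
    using factor.prems(2)[of s] that by simp
  ultimately have "[:x:] dvd q'" using factor.IH by blast
  then show ?case unfolding eq q' by (rule mult_dvd_mono[OF dvd_refl])
qed

lemma primitive_const_dvd_mult:
  fixes p q :: "'a::{factorial_semiring, idom} poly"
  assumes "primitive_poly p" "d \<noteq> 0" "[:d:] dvd p * q"
  shows "[:d:] dvd q"
  using assms const_dvd_mult_cancel[of d p q] by (auto simp: primitive_poly_def)

section \<open>Clearing denominators and splitting off the primitive part\<close>

lemma fract_poly_clear_denominators:
  fixes h :: "'a::idom fract poly"
  shows "\<exists>d w. d \<noteq> 0 \<and> smult (to_fract d) h = fract_poly w"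
proof (induction h)
  case 0
  show ?case by (rule exI[of _ 1], rule exI[of _ 0]) simp
next
  case (pCons a h)
  then obtain d w where dw: "d \<noteq> 0" "smult (to_fract d) h = fract_poly w" by blast
  obtain x y where xy: "a = Fract x y" "y \<noteq> 0" by (cases a) auto
  have "to_fract (d * y) * a = to_fract (d * x)"
    using xy by (simp add: Fract_conv_to_fract)
  moreover have "smult (to_fract (d * y)) h = fract_poly (smult y w)"
    by (simp add: mult.commute flip: dw(2))
  ultimately have "smult (to_fract (d * y)) (pCons a h) = fract_poly (pCons (d * x) (smult y w))"
    by (simp only: smult_pCons map_poly_pCons to_fract_0)
  then show ?case using dw xy by (metis mult_eq_0_iff)
qed

text \<open>Among all \<open>p\<close> with \<open>w = smult c p\<close>, one whose leading
  coefficient has the fewest prime factors is primitive: a prime constant dividing \<open>p\<close>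
  could be moved into \<open>c\<close>, lowering that number.\<close>

lemma primitive_decomposition:
  fixes w :: "'a::{factorial_semiring, idom} poly"
  assumes "w \<noteq> 0"
  obtains c p where "c \<noteq> 0" "primitive_poly p" "w = smult c p"
proof -
  let ?S = "\<lambda>p. \<exists>c. w = smult c p"
  obtain p where p: "?S p"
    "\<And>q. ?S q \<Longrightarrow> size (prime_factorization (lead_coeff p)) \<le> size (prime_factorization (lead_coeff q))"
    using ex_has_least_nat[of ?S w "\<lambda>p. size (prime_factorization (lead_coeff p))"]
    by (metis smult_1_left)
  then obtain c where c: "w = smult c p" by blast
  have "\<not> [:r:] dvd p" if r: "prime r" for r
  proof
    assume "[:r:] dvd p"
    then obtain q where q: "p = smult r q" by auto
    then have "lead_coeff q \<noteq> 0" using c assms by auto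
    then have "size (prime_factorization (lead_coeff p)) > size (prime_factorization (lead_coeff q))"
      using r by (simp add: q prime_factorization_times_prime)
    moreover have "?S q" using c q by auto
    ultimately show False using p(2) by fastforce
  qed
  moreover have "c \<noteq> 0" using assms c by auto
  ultimately show thesis using that c by (auto simp: primitive_poly_def)
qed

text \<open>Choosing a denominator \<open>d\<close> with the fewest prime factors puts the fraction
  \<open>c/d\<close> in lowest terms, because a common prime of \<open>c\<close> and
  \<open>d\<close> could be cancelled. This coprimality is what later makes \<open>d\<close> divide
  the values of \<open>p\<close>.\<close>

lemma fract_primitive_decomposition:
  fixes h :: "'a::{factorial_semiring, idom} fract poly"
  assumes "h \<noteq> 0"
  obtains c d p where "c \<noteq> 0" "d \<noteq> 0" "primitive_poly p"
    "smult (to_fract d) h = fract_poly (smult c p)"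
    "\<And>r. prime r \<Longrightarrow> r dvd d \<Longrightarrow> \<not> r dvd c"
proof -
  let ?S = "\<lambda>d. d \<noteq> 0 \<and> (\<exists>w. smult (to_fract d) h = fract_poly w)"
  obtain d where d: "?S d"
    "\<And>e. ?S e \<Longrightarrow> size (prime_factorization d) \<le> size (prime_factorization e)"
    using fract_poly_clear_denominators[of h] ex_has_least_nat[of ?S _ "\<lambda>d. size (prime_factorization d)"]
    by metis
  then obtain w where w: "smult (to_fract d) h = fract_poly w" by blast
  have "w \<noteq> 0"
  proof
    assume "w = 0"
    then show False using w d assms by simp
  qed
  then obtain c p where cp: "c \<noteq> 0" "primitive_poly p" "w = smult c p"
    by (rule primitive_decomposition)
  have "\<not> r dvd c" if r: "prime r" "r dvd d" for r
  proof
    assume "r dvd c"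
    then obtain c' d' where cd: "c = r * c'" "d = r * d'" using r by (auto elim!: dvdE)
    have r0: "r \<noteq> 0" and d0: "d' \<noteq> 0" using r d cd by auto
    have "smult (to_fract r) (smult (to_fract d') h) = smult (to_fract r) (fract_poly (smult c' p))"
      using w cp cd by simp
    then have "smult (to_fract d') h = fract_poly (smult c' p)"
      using r0 by (metis smult_eq_iff to_fract_eq_0_iff smult_smult smult_1_left left_inverse)
    then have "?S d'" using d0 by blast
    moreover have "size (prime_factorization d') < size (prime_factorization d)"
      using r d0 by (simp add: cd prime_factorization_times_prime)
    ultimately show False using d(2) by fastforce
  qed
  then show thesis using that cp d w by blast
qed

section \<open>Gauss's lemma and irreducibility over \<open>R\<close> and over
  \<open>K\<close>\<close>

text \<open>Clearing the denominator \<open>d\<close> of the quotient in \<open>K[X]\<close> gives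
  \<open>d q = p w\<close>; as \<open>p\<close> is primitive, \<open>d\<close> divides
  \<open>w\<close> and cancels.\<close>

lemma primitive_fract_poly_dvdD:
  fixes p q :: "'a::{factorial_semiring, idom} poly"
  assumes "primitive_poly p" "fract_poly p dvd fract_poly q"
  shows "p dvd q"
proof -
  obtain s where s: "fract_poly q = fract_poly p * s" using assms by auto
  obtain d w where dw: "d \<noteq> 0" "smult (to_fract d) s = fract_poly w"
    using fract_poly_clear_denominators by blast
  have "fract_poly (smult d q) = fract_poly (p * w)"
    by (simp add: s del: fract_poly_eq_iff flip: dw(2))
  then have eq: "[:d:] * q = p * w" by (simp only: fract_poly_eq_iff) simp
  then have "[:d:] dvd w" using primitive_const_dvd_mult[OF assms(1) dw(1)] by (metis dvd_triv_left)
  then obtain w' where "w = [:d:] * w'" by auto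
  then have "[:d:] * q = [:d:] * (p * w')" using eq by (simp only: mult.left_commute)
  then have "q = p * w'" using dw(1) by (simp only: mult_cancel_left) simp
  then show ?thesis by simp
qed

lemma primitive_poly_dvd:
  "primitive_poly p \<Longrightarrow> q dvd p \<Longrightarrow> primitive_poly q"
  by (auto simp: primitive_poly_def intro: dvd_trans)

lemma primitive_const_is_unit:
  assumes "primitive_poly p" "degree p = 0" "p \<noteq> 0"
  shows "p dvd 1"
proof -
  obtain a where a: "p = [:a:]" using assms by (auto elim: degree_eq_zeroE)
  then have "a \<noteq> 0" "\<And>r. prime r \<Longrightarrow> \<not> r dvd a" using assms by (auto simp: primitive_poly_def)
  then have "a dvd 1" using prime_divisor_exists by blast
  then show ?thesis using a by (simp add: is_unit_const_poly_iff)
qed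

lemma degree_fract_poly [simp]: "degree (fract_poly p) = degree p"
  by (simp add: degree_map_poly)

lemma fract_poly_power: "fract_poly (p ^ n) = fract_poly p ^ n"
  by (induction n) simp_all

lemma irreducible_dvdD:
  fixes a b :: "'a::comm_semiring_1"
  assumes "irreducible a" "b dvd a"
  shows "a dvd b \<or> b dvd 1"
proof -
  obtain c where c: "a = b * c" using assms(2) by (rule dvdE)
  then have "b dvd 1 \<or> c dvd 1" using assms(1) by (rule irreducibleD[rotated])
  moreover have "a dvd b" if c1: "c dvd 1"
  proof -
    obtain e where "1 = c * e" using c1 by (rule dvdE)
    then have "b = a * e" using c by (metis mult.assoc mult_1_right)
    then show ?thesis by simp
  qed
  ultimately show ?thesis by blast
qed

text \<open>A prime constant dividing \<open>g\<close> is not a unit, so \<open>g\<close> would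
  divide it back, which its degree forbids.\<close>

lemma irreducible_imp_primitive:
  fixes g :: "'a::{factorial_semiring, idom} poly"
  assumes "irreducible g" "degree g > 0"
  shows "primitive_poly g"
  unfolding primitive_poly_def
proof (intro allI impI notI)
  fix r :: 'a assume r: "prime r" "[:r:] dvd g"
  have "\<not> [:r:] dvd 1" using r by (auto simp: is_unit_const_poly_iff)
  then have "g dvd [:r:]" using irreducible_dvdD[OF assms(1) r(2)] by blast
  then have "degree g \<le> degree [:r:]" using r by (intro dvd_imp_degree_le) auto
  then show False using assms by simp
qed

text \<open>From \<open>K\<close> to \<open>R\<close>: a factor of degree 0 inherits primitivity
  from \<open>p\<close> and is therefore a unit of \<open>R[X]\<close>. From \<open>R\<close> to
  \<open>K\<close>: a factor in \<open>K[X]\<close> has the same degree as its primitive part, and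
  that part divides \<open>p\<close> already in \<open>R[X]\<close> by Gauss's lemma.\<close>

lemma irreducible_fract_poly_iff:
  fixes p :: "'a::{factorial_semiring, idom} poly"
  assumes "primitive_poly p"
  shows "irreducible (fract_poly p) \<longleftrightarrow> irreducible p"
proof
  assume irr: "irreducible (fract_poly p)"
  show "irreducible p"
  proof (rule irreducibleI)
    show "p \<noteq> 0" "\<not> p dvd 1" using irr by (auto dest: fract_poly_is_unit simp: irreducible_def)
    fix a b assume ab: "p = a * b"
    have "a \<noteq> 0" "b \<noteq> 0" using \<open>p \<noteq> 0\<close> ab by auto
    have "fract_poly a dvd 1 \<or> fract_poly b dvd 1"
      using irr ab by (intro irreducibleD) auto
    then have "degree a = 0 \<or> degree b = 0"
      using \<open>a \<noteq> 0\<close> \<open>b \<noteq> 0\<close> by (auto simp: is_unit_iff_degree)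
    moreover have "primitive_poly a" "primitive_poly b"
      using assms ab by (auto intro: primitive_poly_dvd)
    ultimately show "a dvd 1 \<or> b dvd 1"
      using \<open>a \<noteq> 0\<close> \<open>b \<noteq> 0\<close> primitive_const_is_unit by blast
  qed
next
  assume irr: "irreducible p"
  then have p0: "p \<noteq> 0" by auto
  show "irreducible (fract_poly p)"
  proof (rule irreducibleI)
    show "fract_poly p \<noteq> 0" using p0 by simp
    show "\<not> fract_poly p dvd 1"
      using primitive_const_is_unit[OF assms] irr p0 by (auto simp: is_unit_iff_degree irreducible_def)
    fix a b assume ab: "fract_poly p = a * b"
    have ab0: "a \<noteq> 0" "b \<noteq> 0" using ab p0 by (metis fract_poly_eq_0_iff mult_eq_0_iff)+
    have deg: "degree p = degree a + degree b"
      using ab0 arg_cong[OF ab, of degree] by (simp add: degree_mult_eq)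
    obtain c d a' where a': "c \<noteq> 0" "d \<noteq> 0" "primitive_poly a'"
      "smult (to_fract d) a = fract_poly (smult c a')"
      using fract_primitive_decomposition[OF ab0(1)] by metis
    have dega: "degree a = degree a'" 
      using arg_cong[OF a'(4), of degree] a'(1,2) by (simp del: fract_poly_smult)
    have "fract_poly a' dvd smult (to_fract d) a" using a' by (simp add: dvd_smult)
    then have "fract_poly a' dvd fract_poly p"
      using a'(2) ab by (simp add: dvd_smult_iff)
    then have "a' dvd p" by (rule primitive_fract_poly_dvdD[OF a'(3)])
    then obtain b' where b': "p = a' * b'" by auto
    then have "a' \<noteq> 0" "b' \<noteq> 0" using p0 by auto
    then have "degree p = degree a' + degree b'" using b' by (simp add: degree_mult_eq)
    moreover have "degree a' = 0 \<or> degree b' = 0"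
      using irreducibleD[OF irr b'] by (auto elim!: is_unit_polyE)
    ultimately have "degree a = 0 \<or> degree b = 0" using deg dega by simp
    then show "a dvd 1 \<or> b dvd 1" using ab0 by (simp add: is_unit_iff_degree)
  qed
qed

section \<open>The divisor monoid\<close>

lemma int_valued_mult: "g \<in> int_valued \<Longrightarrow> h \<in> int_valued \<Longrightarrow> g * h \<in> int_valued"
  unfolding int_valued_def by (auto simp: image_iff) (metis to_fract_mult)

lemma poly_fract_poly: "poly (fract_poly p) (to_fract x) = to_fract (poly p x)"
  by (induction p) (simp_all add: map_poly_pCons)

lemma fract_poly_int_valued: "fract_poly p \<in> int_valued"
  by (simp add: int_valued_def poly_fract_poly)

lemma divisor_monoid_nonzero: "g \<in> divisor_monoid F \<Longrightarrow> g \<noteq> 0"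
  by (simp add: divisor_monoid_def)

lemma divisor_monoid_int_valued: "g \<in> divisor_monoid F \<Longrightarrow> g \<in> int_valued"
  by (simp add: divisor_monoid_def)

lemma divisor_monoidI:
  assumes "g \<in> int_valued" "g \<noteq> 0" "h \<in> int_valued" "F ^ k = g * h"
  shows "g \<in> divisor_monoid F"
  using assms unfolding divisor_monoid_def by blast

lemma divisor_monoidE:
  assumes "g \<in> divisor_monoid F"
  obtains k h where "h \<in> int_valued" "F ^ k = g * h"
  using assms by (auto simp: divisor_monoid_def)

lemma divisor_monoid_mult:
  assumes "g \<in> divisor_monoid F" "h \<in> divisor_monoid F"
  shows "g * h \<in> divisor_monoid F"
proof -
  obtain k g' where g: "g' \<in> int_valued" "F ^ k = g * g'" using assms(1) by (rule divisor_monoidE)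
  obtain l h' where h: "h' \<in> int_valued" "F ^ l = h * h'" using assms(2) by (rule divisor_monoidE)
  have "F ^ (k + l) = (g * h) * (g' * h')" using g h by (simp add: power_add algebra_simps)
  then show ?thesis
    using g h assms[THEN divisor_monoid_nonzero] assms[THEN divisor_monoid_int_valued]
    by (intro divisor_monoidI[of _ "g' * h'" _ "k + l"]) (auto intro: int_valued_mult)
qed

lemma divisor_monoid_factor:
  assumes "g * h \<in> divisor_monoid F" "g \<in> int_valued" "h \<in> int_valued"
  shows "g \<in> divisor_monoid F"
proof -
  obtain k s where s: "s \<in> int_valued" "F ^ k = (g * h) * s" using assms(1) by (rule divisor_monoidE)
  then have "F ^ k = g * (h * s)" by (simp add: mult.assoc)
  then show ?thesis
    using assms s divisor_monoid_nonzero[OF assms(1)]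
    by (intro divisor_monoidI[of _ "h * s" _ k]) (auto intro: int_valued_mult)
qed

text \<open>A unit divides \<open>F ^ 0 = 1\<close>, so the exponent 0 works for every
  \<open>F\<close>.\<close>

lemma unit_in_divisor_monoid:
  assumes "u dvd 1"
  shows "fract_poly u \<in> divisor_monoid F"
proof -
  obtain v where v: "1 = u * v" using assms by auto
  then have "F ^ 0 = fract_poly u * fract_poly v" by (simp flip: fract_poly_mult)
  moreover have "u \<noteq> 0" using v by auto
  ultimately show ?thesis
    by (intro divisor_monoidI[of _ "fract_poly v" _ 0]) (simp_all add: fract_poly_int_valued)
qed

lemma one_in_divisor_monoid: "1 \<in> divisor_monoid F"
  using unit_in_divisor_monoid[of 1 F] by simp

lemma divisor_monoid_fract_poly_dvd:
  assumes "fract_poly q \<in> divisor_monoid F" "p dvd q"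
  shows "fract_poly p \<in> divisor_monoid F"
  using assms by (auto elim!: dvdE intro: divisor_monoid_factor fract_poly_int_valued)

section \<open>Passing between the divisor monoid and \<open>R[X]\<close>\<close>

text \<open>Provides a multiple of \<open>g\<close> that lies both in the monoid and in
  \<open>R[X]\<close>, so that Gauss's lemma can be applied to its primitive divisors.\<close>

lemma divisor_monoid_is_power_divisor:
  assumes "f \<noteq> 0" "g \<in> divisor_monoid (fract_poly f)"
  obtains k where "g dvd fract_poly (f ^ k)" "fract_poly (f ^ k) \<in> divisor_monoid (fract_poly f)"
proof -
  obtain k h where h: "h \<in> int_valued" "fract_poly f ^ k = g * h"
    using assms(2) by (rule divisor_monoidE)
  have "fract_poly f ^ k = fract_poly (f ^ k) * 1" by (simp add: fract_poly_power)
  moreover have "(1 :: 'a fract poly) \<in> int_valued" using fract_poly_int_valued[of 1] by simp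
  moreover have "fract_poly (f ^ k) \<noteq> 0" using assms(1) by simp
  ultimately have "fract_poly (f ^ k) \<in> divisor_monoid (fract_poly f)"
    using divisor_monoidI fract_poly_int_valued by blast
  then show thesis using that h fract_poly_power by (metis dvd_triv_left)
qed

text \<open>Divisibility in \<open>K[X]\<close> suffices here: \<open>p\<close> divides a power of
  \<open>f\<close> in \<open>K[X]\<close>, hence in \<open>R[X]\<close> by Gauss's lemma, and the
  cofactor is then integer-valued.\<close>

lemma primitive_in_divisor_monoid:
  fixes f p :: "'a::{factorial_semiring, idom} poly"
  assumes "f \<noteq> 0" "g \<in> divisor_monoid (fract_poly f)" "primitive_poly p" "fract_poly p dvd g"
  shows "fract_poly p \<in> divisor_monoid (fract_poly f)"
proof -
  obtain k where k: "g dvd fract_poly (f ^ k)" "fract_poly (f ^ k) \<in> divisor_monoid (fract_poly f)"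
    using divisor_monoid_is_power_divisor[OF assms(1,2)] .
  have "p dvd f ^ k"
    using assms k by (intro primitive_fract_poly_dvdD) (auto intro: dvd_trans)
  then show ?thesis using k divisor_monoid_fract_poly_dvd by blast
qed

text \<open>
  Write \<open>d h = c p\<close> with \<open>p\<close> primitive and \<open>c\<close>, \<open>d\<close> without common prime, and let \<open>h h' = f\<^sup>n\<close>.
  The values of \<open>p\<close> are then divisible by \<open>d\<close>, and \<open>(c/d) h'\<close> lies in \<open>R[X]\<close> by Gauss's lemma, so
  \<open>d\<close> times \<open>(p/d) ((c/d) h')\<close> is a factorization of \<open>f\<^sup>n\<close> inside \<open>Int(R)\<close>.
\<close>
lemma denominator_in_divisor_monoid:
  fixes f :: "'a::{factorial_semiring, idom} poly"
  assumes "f \<noteq> 0" "h \<in> divisor_monoid (fract_poly f)"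
  obtains d w where "[:to_fract d:] \<in> divisor_monoid (fract_poly f)"
    "[:to_fract d:] * h = fract_poly w"
proof -
  have "h \<noteq> 0" using assms(2) by (rule divisor_monoid_nonzero)
  then obtain c d p where cdp: "c \<noteq> 0" "d \<noteq> 0" "primitive_poly p"
    "smult (to_fract d) h = fract_poly (smult c p)"
    "\<And>r. prime r \<Longrightarrow> r dvd d \<Longrightarrow> \<not> r dvd c"
    by (rule fract_primitive_decomposition) blast
  have td: "to_fract d \<noteq> 0" using cdp by simp
  obtain k h' where h': "h' \<in> int_valued" "fract_poly f ^ k = h * h'"
    using assms(2) by (rule divisor_monoidE)

  define p' where "p' = smult (inverse (to_fract d)) (fract_poly p)"
  have dp': "smult (to_fract d) p' = fract_poly p" using td by (simp add: p'_def)
  have p'_int: "p' \<in> int_valued"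
    unfolding int_valued_def
  proof (intro CollectI allI)
    fix x
    have "poly h (to_fract x) \<in> range to_fract"
      using divisor_monoid_int_valued[OF assms(2)] by (simp add: int_valued_def)
    then obtain y where y: "poly h (to_fract x) = to_fract y" by blast
    have "to_fract (d * y) = to_fract (c * poly p x)"
      using arg_cong[OF cdp(4), of "\<lambda>q. poly q (to_fract x)"] by (simp add: y poly_fract_poly)
    then have "d * y = c * poly p x" by (simp only: to_fract_eq_iff)
    \<comment> \<open>The equation between values is lifted to constant polynomials, so that the
      cancellation lemma for constants applies with the coprime pair \<open>c\<close>,
      \<open>d\<close> and yields that \<open>d\<close> divides \<open>poly p x\<close>.\<close>
    then have "[:c:] * [:poly p x:] = [:d:] * [:y:]" by (simp add: mult.commute)
    then have "[:d:] dvd [:c:] * [:poly p x:]" by (metis dvd_triv_left)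
    then have "[:d:] dvd [:poly p x:]"
      using cdp by (elim const_dvd_mult_cancel[rotated 2]) auto
    then obtain z where "poly p x = d * z" by auto
    then have "poly p' (to_fract x) = to_fract z" using td by (simp add: p'_def poly_fract_poly)
    then show "poly p' (to_fract x) \<in> range to_fract" by simp
  qed

  define s where "s = smult (to_fract c * inverse (to_fract d)) h'"
  have ps: "fract_poly p * s = fract_poly (f ^ k)"
  proof -
    have "fract_poly p * s = smult (inverse (to_fract d)) (smult (to_fract c) (fract_poly p) * h')"
      by (simp add: s_def mult.commute)
    also have "\<dots> = smult (inverse (to_fract d)) (smult (to_fract d) h * h')"
      using cdp(4) by simp
    also have "\<dots> = h * h'" using td by simp
    finally show ?thesis using h' by (simp add: fract_poly_power)
  qed
  then have "p dvd f ^ k"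
    by (intro primitive_fract_poly_dvdD[OF cdp(3)]) (metis dvd_triv_left)
  then obtain t where "f ^ k = p * t" by auto
  then have "fract_poly p * s = fract_poly p * fract_poly t" using ps by simp
  moreover have "fract_poly p \<noteq> 0"
    using ps assms(1) by (metis mult_zero_left fract_poly_eq_0_iff power_not_zero)
  ultimately have s_int: "s \<in> int_valued" using fract_poly_int_valued by simp

  have "fract_poly f ^ k = [:to_fract d:] * (p' * s)"
    using ps by (simp add: fract_poly_power flip: dp')
  moreover have "[:to_fract d:] \<in> int_valued" by (simp add: int_valued_def)
  ultimately have "[:to_fract d:] \<in> divisor_monoid (fract_poly f)"
    using int_valued_mult[OF p'_int s_int] td by (intro divisor_monoidI) auto
  moreover have "[:to_fract d:] * h = fract_poly (smult c p)" using cdp by simp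
  ultimately show thesis by (rule that)
qed

section \<open>Prime ideals without constants\<close>

lemma const_polys_iff: "fract_poly g \<in> const_polys \<longleftrightarrow> degree g = 0"
proof
  assume "fract_poly g \<in> const_polys"
  then have "degree (fract_poly g) = 0" by (auto simp: const_polys_def simp del: degree_fract_poly)
  then show "degree g = 0" by simp
qed (auto simp: const_polys_def map_poly_pCons elim!: degree_eq_zeroE)

lemma mem_KX_multiples [simp]: "h \<in> KX_multiples g \<longleftrightarrow> g dvd h"
  by (auto simp: KX_multiples_def)

lemma prime_s_idealD:
  assumes "prime_s_ideal H P" "x \<in> H" "y \<in> H" "x * y \<in> P"
  shows "x \<in> P \<or> y \<in> P"
  using assms by (auto simp: prime_s_ideal_def is_submonoid_def)

lemma s_ideal_mult:
  assumes "s_ideal H P" "x \<in> P" "h \<in> H"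
  shows "x * h \<in> P"
  using assms unfolding s_ideal_def by blast

section \<open>Atoms in prime ideals and minimality\<close>

text \<open>Used twice: to show that every minimal prime disjoint from \<open>R\<close> comes from
  an atom, and to bound from below an arbitrary prime inside a given
  \<open>g K[X] \<inter> H\<close>.\<close>

lemma prime_s_ideal_contains_atom:
  fixes f :: "'a::{factorial_semiring, idom} poly"
  assumes "f \<noteq> 0"
  defines "H \<equiv> divisor_monoid (fract_poly f)"
  assumes P: "prime_s_ideal H P" "P \<noteq> {}" "P \<inter> const_polys = {}"
  obtains g where "irreducible g" "degree g > 0" "fract_poly g \<in> H"
    "KX_multiples (fract_poly g) \<inter> H \<subseteq> P"
proof -
  have ideal: "s_ideal H P" using P by (simp add: prime_s_ideal_def)
  have PH: "P \<subseteq> H" using ideal by (simp add: s_ideal_def)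
  have noconst: "[:to_fract d:] \<notin> P" for d using P(3) by (auto simp: const_polys_def)
  obtain h where "h \<in> P" using P by blast
  then obtain d w where dw: "[:to_fract d:] \<in> H" "[:to_fract d:] * h = fract_poly w"
    using denominator_in_divisor_monoid[OF assms(1), of h] PH unfolding H_def by blast
  have "h * [:to_fract d:] \<in> P" using s_ideal_mult[OF ideal \<open>h \<in> P\<close> dw(1)] .
  then have "fract_poly w \<in> P" by (metis dw(2) mult.commute)
  then obtain v where v: "fract_poly v \<in> P" "\<And>u. fract_poly u \<in> P \<Longrightarrow> degree v \<le> degree u"
    using ex_has_least_nat[of "\<lambda>v. fract_poly v \<in> P" w degree] by blast
  have "v \<noteq> 0" using v(1) PH divisor_monoid_nonzero unfolding H_def by fastforce
  then obtain c g where cg: "c \<noteq> 0" "primitive_poly g" "v = smult c g"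
    by (rule primitive_decomposition)
  have vH: "fract_poly v \<in> H" using v PH by blast
  have v_eq: "v = [:c:] * g" using cg by simp
  have cH: "fract_poly [:c:] \<in> H" and gH: "fract_poly g \<in> H"
    using vH divisor_monoid_fract_poly_dvd v_eq unfolding H_def by (metis dvd_triv_left dvd_triv_right)+
  \<comment> \<open>The content \<open>c\<close> is a constant and so lies outside \<open>P\<close>;
    primality passes membership on to the primitive part, which has the same degree as
    \<open>v\<close>.\<close>
  have "fract_poly [:c:] \<notin> P" using noconst by (simp add: map_poly_pCons)
  then have gP: "fract_poly g \<in> P"
    using prime_s_idealD[OF P(1) cH gH] v(1) by (simp only: v_eq fract_poly_mult) blast
  have deg_g: "degree g > 0" using gP P(3) const_polys_iff[of g] by blast
  have g_min: "degree g \<le> degree u" if "fract_poly u \<in> P" for u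
    using v(2)[OF that] cg by simp
  have "irreducible g"
  proof (rule irreducibleI)
    show "g \<noteq> 0" using deg_g by auto
    show "\<not> g dvd 1" using deg_g by (auto elim: is_unit_polyE)
    fix a b assume ab: "g = a * b"
    have ab0: "a \<noteq> 0" "b \<noteq> 0" using ab \<open>g \<noteq> 0\<close> by auto
    have deg: "degree g = degree a + degree b" using ab ab0 by (simp add: degree_mult_eq)
    have prim: "primitive_poly a" "primitive_poly b"
      using cg(2) ab by (auto intro: primitive_poly_dvd)
    have "fract_poly a \<in> H" "fract_poly b \<in> H"
      using gH divisor_monoid_fract_poly_dvd ab unfolding H_def by (metis dvd_triv_left dvd_triv_right)+
    then have "fract_poly a \<in> P \<or> fract_poly b \<in> P"
      using prime_s_idealD[OF P(1)] gP ab by simp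
    \<comment> \<open>The factor lying in \<open>P\<close> has at least the degree of
      \<open>g\<close>, so the other one is constant; being primitive, it is a unit.\<close>
    then have "degree b = 0 \<or> degree a = 0" using g_min deg by force
    then show "a dvd 1 \<or> b dvd 1" using prim ab0 primitive_const_is_unit by blast
  qed
  moreover have "KX_multiples (fract_poly g) \<inter> H \<subseteq> P"
  proof
    fix x assume "x \<in> KX_multiples (fract_poly g) \<inter> H"
    then have x: "fract_poly g dvd x" "x \<in> H" by auto
    \<comment> \<open>With a denominator \<open>d\<close> of \<open>x\<close>, the product
      \<open>d x\<close> equals \<open>g y\<close> with \<open>y\<close> in \<open>H\<close>, so it
      lies in \<open>P\<close>. The constant \<open>d\<close> does not, which leaves
      \<open>x\<close>.\<close>
    obtain d w where dw: "[:to_fract d:] \<in> H" "[:to_fract d:] * x = fract_poly w"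
      using denominator_in_divisor_monoid[OF assms(1), of x] x(2) unfolding H_def by blast
    have "fract_poly g dvd fract_poly w" using x(1) by (simp flip: dw(2) add: dvd_smult)
    then have "g dvd w" by (rule primitive_fract_poly_dvdD[OF cg(2)])
    then obtain y where y: "w = g * y" by auto
    have "fract_poly w \<in> H" using divisor_monoid_mult dw x(2) unfolding H_def by metis
    then have "fract_poly y \<in> H"
      using divisor_monoid_fract_poly_dvd y unfolding H_def by (metis dvd_triv_right)
    then have "[:to_fract d:] * x \<in> P"
      using s_ideal_mult[OF ideal gP] by (simp only: dw(2) y fract_poly_mult)
    then show "x \<in> P" using prime_s_idealD[OF P(1) dw(1) x(2)] noconst by blast
  qed
  ultimately show thesis using that deg_g gH by blast
qed

text \<open>Irreducible elements of \<open>K[X]\<close> are prime, and primality of \<open>g\<close>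
  makes the complement multiplicatively closed. Nothing is said about nonemptiness: the set is empty
  if \<open>g\<close> does not divide \<open>F\<close>, which the notion of prime
  \<open>s\<close>-ideal permits.\<close>

lemma prime_s_ideal_KX_multiples:
  assumes "irreducible g"
  shows "prime_s_ideal (divisor_monoid F) (KX_multiples g \<inter> divisor_monoid F)"
proof -
  let ?H = "divisor_monoid F" and ?P = "KX_multiples g \<inter> divisor_monoid F"
  have prime: "prime_elem g" using assms by (rule field_poly_irreducible_imp_prime)
  have "?P \<subseteq> {x * h |x h. x \<in> ?P \<and> h \<in> ?H}"
  proof
    fix x assume "x \<in> ?P"
    then show "x \<in> {x * h |x h. x \<in> ?P \<and> h \<in> ?H}"
      using one_in_divisor_monoid[of F] by (intro CollectI exI[of _ x] exI[of _ 1]) simp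
  qed
  moreover have "{x * h |x h. x \<in> ?P \<and> h \<in> ?H} \<subseteq> ?P"
    by (auto intro: divisor_monoid_mult)
  ultimately have "s_ideal ?H ?P" unfolding s_ideal_def by blast
  moreover have one: "1 \<notin> ?P" using assms by (auto simp: irreducible_def)
  moreover have "is_submonoid (?H - ?P)"
    using prime one one_in_divisor_monoid[of F]
    by (auto simp: is_submonoid_def prime_elem_dvd_mult_iff intro: divisor_monoid_mult)
  ultimately show ?thesis using one_in_divisor_monoid[of F] by (auto simp: prime_s_ideal_def)
qed

lemma KX_multiples_eq_imp_dvd:
  assumes "g \<in> H" "h \<in> H" "KX_multiples g \<inter> H = KX_multiples h \<inter> H"
  shows "g dvd h" "h dvd g"
  using assms by (metis IntI IntD1 dvd_refl mem_KX_multiples)+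

lemma KX_multiples_cong: "g dvd h \<Longrightarrow> h dvd g \<Longrightarrow> KX_multiples g = KX_multiples h"
  by (auto intro: dvd_trans)

text \<open>A smaller nonempty prime \<open>Q\<close> also avoids \<open>R\<close>, hence contains
  \<open>g' K[X] \<inter> H\<close> for an atom \<open>g'\<close>. As \<open>g'\<close> is a
  multiple of \<open>g\<close> and both are irreducible in \<open>R[X]\<close>, they divide each
  other and the three ideals coincide.\<close>

lemma minimal_prime_KX_multiples:
  fixes f g :: "'a::{factorial_semiring, idom} poly"
  assumes "f \<noteq> 0"
  defines "H \<equiv> divisor_monoid (fract_poly f)"
  assumes g: "irreducible g" "degree g > 0" "fract_poly g \<in> H"
  shows "KX_multiples (fract_poly g) \<inter> H \<in> \<XX> H"
    and "KX_multiples (fract_poly g) \<inter> H \<inter> const_polys = {}"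
proof -
  let ?P = "KX_multiples (fract_poly g) \<inter> H"
  have prim: "primitive_poly g" using g irreducible_imp_primitive by blast
  have irr: "irreducible (fract_poly g)" using prim g irreducible_fract_poly_iff by blast
  \<comment> \<open>Elements of \<open>H\<close> are nonzero, so a multiple of \<open>g\<close> has
    at least the degree of \<open>g\<close>.\<close>
  have "degree x > 0" if "x \<in> ?P" for x
  proof -
    have "x \<noteq> 0" "fract_poly g dvd x" using that divisor_monoid_nonzero unfolding H_def by auto
    then have "degree (fract_poly g) \<le> degree x" by (intro dvd_imp_degree_le)
    then show ?thesis using g by simp
  qed
  then show const: "?P \<inter> const_polys = {}" by (fastforce simp: const_polys_def)
  have "Q = ?P" if Q: "prime_s_ideal H Q" "Q \<noteq> {}" "Q \<subseteq> ?P" for Q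
  proof -
    have "Q \<inter> const_polys = {}" using Q const by blast
    then obtain g' where g': "irreducible g'" "degree g' > 0" "fract_poly g' \<in> H"
      "KX_multiples (fract_poly g') \<inter> H \<subseteq> Q"
      using prime_s_ideal_contains_atom[OF assms(1)] Q unfolding H_def by metis
    have "fract_poly g' \<in> Q" using g'(3,4) by auto
    then have "fract_poly g' \<in> ?P" using Q by blast
    then have "g dvd g'" by (intro primitive_fract_poly_dvdD[OF prim]) simp
    moreover have "\<not> g dvd 1" using g by (simp add: irreducible_def)
    ultimately have "g' dvd g" using irreducible_dvdD[OF g'(1)] by blast
    then have "fract_poly g' dvd fract_poly g" by (rule fract_poly_dvd)
    then have "?P \<subseteq> KX_multiples (fract_poly g') \<inter> H" by (auto intro: dvd_trans)
    then show ?thesis using g' Q by blast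
  qed
  moreover have "prime_s_ideal H ?P"
    using prime_s_ideal_KX_multiples[OF irr] unfolding H_def by blast
  moreover have "fract_poly g \<in> ?P" using g by simp
  ultimately show "?P \<in> \<XX> H" unfolding minimal_prime_s_ideals_def by blast
qed

lemma atoms_RX_nonconst_iff:
  "h \<in> D \<inter> atoms_RX - const_polys \<longleftrightarrow>
     (\<exists>g. h = fract_poly g \<and> irreducible g \<and> degree g > 0 \<and> fract_poly g \<in> D)"
  using const_polys_iff by (auto simp: atoms_RX_def)

lemma minimal_primes_without_constants:
  fixes f :: "'a::{factorial_semiring, idom} poly"
  assumes "f \<noteq> 0"
  defines "H \<equiv> divisor_monoid (fract_poly f)"
  shows "{P \<in> \<XX> H. P \<inter> const_polys = {}} =
    {KX_multiples g \<inter> H | g. g \<in> (H \<inter> atoms_RX) - const_polys}" (is "?L = ?R")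
proof
  show "?R \<subseteq> ?L"
    using minimal_prime_KX_multiples[OF assms(1)] unfolding H_def atoms_RX_nonconst_iff by blast
  show "?L \<subseteq> ?R"
  proof
    fix P assume "P \<in> ?L"
    then have P: "prime_s_ideal H P" "P \<noteq> {}" "P \<inter> const_polys = {}"
      and min: "\<And>Q. prime_s_ideal H Q \<Longrightarrow> Q \<noteq> {} \<Longrightarrow> Q \<subseteq> P \<Longrightarrow> Q = P"
      by (auto simp: minimal_prime_s_ideals_def)
    obtain g where g: "irreducible g" "degree g > 0" "fract_poly g \<in> H"
      "KX_multiples (fract_poly g) \<inter> H \<subseteq> P"
      using prime_s_ideal_contains_atom[OF assms(1)] P unfolding H_def by metis
    have "KX_multiples (fract_poly g) \<inter> H \<in> \<XX> H"
      using minimal_prime_KX_multiples[OF assms(1)] g unfolding H_def by blast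
    then have "KX_multiples (fract_poly g) \<inter> H = P"
      using min g(4) by (auto simp: minimal_prime_s_ideals_def)
    then show "P \<in> ?R" using g atoms_RX_nonconst_iff by blast
  qed
qed

section \<open>Atoms of \<open>K[X]\<close> compared with atoms of \<open>R[X]\<close>\<close>

text \<open>An atom \<open>g\<close> of \<open>K[X]\<close> in \<open>H\<close> need not lie in
  \<open>R[X]\<close>, but it differs from its primitive part \<open>p\<close> by a nonzero constant
  of \<open>K\<close> only. So \<open>g\<close> and \<open>p\<close> have the same multiples in
  \<open>K[X]\<close>, and Gauss's lemma makes \<open>p\<close> an atom of \<open>R[X]\<close> lying
  in \<open>H\<close>.\<close>

lemma atoms_RX_KX_same_ideals:
  fixes f :: "'a::{factorial_semiring, idom} poly"
  assumes "f \<noteq> 0"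
  defines "H \<equiv> divisor_monoid (fract_poly f)"
  shows "{KX_multiples g \<inter> H | g. g \<in> (H \<inter> atoms_RX) - const_polys} =
    {KX_multiples g \<inter> H | g. g \<in> H \<inter> atoms_KX}" (is "?L = ?R")
proof
  show "?L \<subseteq> ?R"
    unfolding atoms_RX_nonconst_iff
    using irreducible_imp_primitive irreducible_fract_poly_iff by (fastforce simp: atoms_KX_def)
  show "?R \<subseteq> ?L"
  proof
    fix P assume "P \<in> ?R"
    then obtain g where g: "P = KX_multiples g \<inter> H" "g \<in> H" "irreducible g"
      by (auto simp: atoms_KX_def)
    then have "g \<noteq> 0" by auto
    then obtain c d p where cdp: "c \<noteq> 0" "d \<noteq> 0" "primitive_poly p"
      "smult (to_fract d) g = fract_poly (smult c p)"
      by (rule fract_primitive_decomposition) blast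
    have "fract_poly p dvd smult (to_fract d) g" using cdp by (simp add: dvd_smult)
    then have pg: "fract_poly p dvd g" using cdp(2) dvd_smult_iff[of "to_fract d"] by (metis to_fract_eq_0_iff)
    have "g dvd smult (to_fract c) (fract_poly p)" using cdp(4) by (metis dvd_smult dvd_refl fract_poly_smult)
    then have gp: "g dvd fract_poly p" using cdp(1) dvd_smult_iff[of "to_fract c"] by (metis to_fract_eq_0_iff)
    have "\<not> fract_poly p dvd 1" using g(3) gp by (auto simp: irreducible_def intro: dvd_trans)
    then have irr: "irreducible (fract_poly p)" using irreducible_mono[OF g(3) pg] by blast
    then have "degree p > 0"
      using \<open>\<not> fract_poly p dvd 1\<close> irr is_unit_iff_degree[of "fract_poly p"]
      by (metis degree_fract_poly gr0I not_irreducible_zero)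
    moreover have "irreducible p" using irr cdp irreducible_fract_poly_iff by blast
    moreover have "fract_poly p \<in> H"
      using primitive_in_divisor_monoid[OF assms(1)] g(2) cdp(3) pg unfolding H_def by blast
    moreover have "P = KX_multiples (fract_poly p) \<inter> H"
      using KX_multiples_cong[OF pg gp] g(1) by simp
    ultimately show "P \<in> ?L" unfolding atoms_RX_nonconst_iff by blast
  qed
qed

section \<open>Associated atoms and systems of representatives\<close>

lemma is_unit_in_monoid_units:
  assumes "u dvd 1"
  shows "fract_poly u \<in> monoid_units (divisor_monoid F)"
proof -
  obtain v where v: "1 = u * v" using assms by auto
  then have "v dvd 1" by (metis dvd_triv_right)
  then show ?thesis using assms v unit_in_divisor_monoid unfolding monoid_units_def
    by (metis (mono_tags, lifting) fract_poly_1 fract_poly_mult mem_Collect_eq)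
qed

lemma associated_in_KX_multiples:
  assumes "associated_in H g h"
  shows "KX_multiples g = KX_multiples h"
proof -
  obtain u v where uv: "g = u * h" "u * v = 1"
    using assms by (auto simp: associated_in_def monoid_units_def)
  then have "v * g = h" by (metis mult.assoc mult.commute mult_1)
  then show ?thesis using uv by (intro KX_multiples_cong) (metis dvd_triv_right)+
qed

text \<open>Equal ideals give mutual divisibility in \<open>K[X]\<close> only; primitivity brings it
  down to \<open>R[X]\<close>, so the quotient is a unit of \<open>R[X]\<close> and thus of
  \<open>H\<close>, not merely a constant of \<open>K\<close>.\<close>

lemma KX_multiples_eq_imp_associated:
  fixes f g h :: "'a::{factorial_semiring, idom} poly"
  defines "H \<equiv> divisor_monoid (fract_poly f)"
  assumes "fract_poly g \<in> H" "fract_poly h \<in> H" "primitive_poly g" "primitive_poly h"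
    "KX_multiples (fract_poly g) \<inter> H = KX_multiples (fract_poly h) \<inter> H"
  shows "associated_in H (fract_poly g) (fract_poly h)"
proof -
  have "g dvd h" "h dvd g"
    using KX_multiples_eq_imp_dvd[OF assms(2,3,6)] assms(4,5) by (auto intro: primitive_fract_poly_dvdD)
  then obtain u v where uv: "g = h * u" "h = g * v" by (meson dvdE)
  have "g \<noteq> 0" using divisor_monoid_nonzero[of "fract_poly g"] assms(2) unfolding H_def by auto
  have "g * 1 = g * (v * u)" using uv by (metis mult.assoc mult_1_right)
  then have "u dvd 1" using \<open>g \<noteq> 0\<close> by (metis dvd_triv_right mult_cancel_left)
  then have "fract_poly u \<in> monoid_units H" unfolding H_def by (rule is_unit_in_monoid_units)
  moreover have "fract_poly g = fract_poly u * fract_poly h" using uv(1) by (simp add: mult.commute)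
  ultimately show ?thesis by (auto simp: associated_in_def)
qed

text \<open>Two nonconstant atoms of \<open>R[X]\<close> in \<open>H\<close> define the same ideal
  exactly when they are associated in \<open>H\<close>, so the ideals correspond to the classes that
  \<open>T\<close> represents.\<close>

lemma representatives_bij_betw:
  fixes f :: "'a::{factorial_semiring, idom} poly"
  defines "H \<equiv> divisor_monoid (fract_poly f)"
  assumes T: "system_of_representatives H ((H \<inter> atoms_RX) - const_polys) T"
  shows "bij_betw (\<lambda>t. KX_multiples t \<inter> H) T
    {KX_multiples g \<inter> H | g. g \<in> (H \<inter> atoms_RX) - const_polys}"
proof -
  let ?E = "(H \<inter> atoms_RX) - const_polys"
  have TE: "T \<subseteq> ?E" and ex1: "\<And>x. x \<in> ?E \<Longrightarrow> \<exists>!y. y \<in> T \<and> associated_in H x y"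
    using T by (auto simp: system_of_representatives_def)
  have assoc: "associated_in H s t"
    if st: "s \<in> ?E" "t \<in> ?E" and eq: "KX_multiples s \<inter> H = KX_multiples t \<inter> H" for s t
  proof -
    obtain g h where "s = fract_poly g" "irreducible g" "degree g > 0" "fract_poly g \<in> H"
      "t = fract_poly h" "irreducible h" "degree h > 0" "fract_poly h \<in> H"
      using st unfolding atoms_RX_nonconst_iff by blast
    then show ?thesis
      using KX_multiples_eq_imp_associated[of g f h] eq irreducible_imp_primitive
      unfolding H_def by blast
  qed
  show ?thesis
    unfolding bij_betw_def
  proof
    show "inj_on (\<lambda>t. KX_multiples t \<inter> H) T"
    proof (rule inj_onI)
      fix s t assume st: "s \<in> T" "t \<in> T" "KX_multiples s \<inter> H = KX_multiples t \<inter> H"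
      \<comment> \<open>Both \<open>s\<close> and \<open>t\<close> are now representatives of
        \<open>s\<close> in \<open>T\<close>, and representatives are unique.\<close>
      then have "associated_in H s s" "associated_in H s t" using assoc TE by blast+
      then show "s = t" using ex1[of s] st TE by blast
    qed
    show "(\<lambda>t. KX_multiples t \<inter> H) ` T = {KX_multiples g \<inter> H | g. g \<in> ?E}"
    proof
      show "(\<lambda>t. KX_multiples t \<inter> H) ` T \<subseteq> {KX_multiples g \<inter> H | g. g \<in> ?E}"
        using TE by blast
      \<comment> \<open>An atom \<open>g\<close> may be replaced by its representative in
        \<open>T\<close>, which has the same multiples.\<close>
      show "{KX_multiples g \<inter> H | g. g \<in> ?E} \<subseteq> (\<lambda>t. KX_multiples t \<inter> H) ` T"
        using ex1 associated_in_KX_multiples by fastforce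
    qed
  qed
qed

theorem corollary3p8:
  fixes f :: "'a::{factorial_semiring, idom} poly"
  assumes "f \<noteq> 0"
  shows
    "{P \<in> \<XX> (divisor_monoid (fract_poly f)). P \<inter> const_polys = {}} =
       {KX_multiples g \<inter> divisor_monoid (fract_poly f) | g.
          g \<in> (divisor_monoid (fract_poly f) \<inter> atoms_RX) - const_polys}
     \<and>
     {KX_multiples g \<inter> divisor_monoid (fract_poly f) | g.
          g \<in> (divisor_monoid (fract_poly f) \<inter> atoms_RX) - const_polys} =
       {KX_multiples g \<inter> divisor_monoid (fract_poly f) | g.
          g \<in> divisor_monoid (fract_poly f) \<inter> atoms_KX}
     \<and>
     (\<forall>T. system_of_representatives (divisor_monoid (fract_poly f))
             ((divisor_monoid (fract_poly f) \<inter> atoms_RX) - const_polys) T \<longrightarrow>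
          bij_betw (\<lambda>t. KX_multiples t \<inter> divisor_monoid (fract_poly f)) T
            {P \<in> \<XX> (divisor_monoid (fract_poly f)). P \<inter> const_polys = {}})"
  \<comment> \<open>This rewriting makes the first equality reflexive and turns the target of the
    bijection into the set of ideals of atoms of \<open>R[X]\<close>.\<close>
  unfolding minimal_primes_without_constants[OF assms]
  using atoms_RX_KX_same_ideals[OF assms] representatives_bij_betw by blast

end
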